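(* Let $F$ be a field, let $G$ be a finite group, and let $\mathcal{L}$ be a sublattice of the lattice of normal subgroups of $G$. Let $F\overline{\mathcal{L}}$ denote the $F$-linear span in $FG$ of $\{\overline{H} : H \in \mathcal{L}\}$. Then $F\overline{\mathcal{L}}$ is a central PS-ring over $G$ with the following properties, for all $H, K \in \mathcal{L}$: (i) $\overline{H}^{(-1)} = \overline{H}$; (ii) $\overline{H} \circ \overline{K} = \overline{H\cap K}$; (iii) $\overline{H}\,\overline{K} = |H\cap K|\,\overline{HK}$; (iv) $F\overline{\mathcal{L}}$ is an S-ring if and only if $1, G \in \mathcal{L}$ (where $1$ denotes the trivial subgroup); (v) $F\overline{\mathcal{L}}$ is rational if and only if $\mathcal{L}$ consists entirely of characteristic subgroups of $G$.
   Context: The lattice of normal subgroups of $G$ has meet $H\cap K$ and join $HK$; a sublattice is a nonempty subset closed under both operations. For $C \subseteq G$ write $\overline{C} = \sum_{g\in C} g \in FG$. For $x = \sum_{g} a_g g \in FG$ and an integer $m$, put $x^{(m)} = \sum_g a_g g^m$; for $C\subseteq G$ put $C^{(m)}=\{g^m : g\in C\}$. The Hadamard product of $x=\sum_g a_g g$ and $y=\sum_g b_g g$ is $x\circ y = \sum_g a_g b_g g$. A PS-ring (pseudo S-ring) over $G$ is a subalgebra $S$ of $FG$ (closed under addition, scalar multiplication and multiplication, not necessarily containing the identity of $FG$) for which there are disjoint nonempty subsets $T_1,\dots,T_n$ of $G$ (the basic sets) such that $\overline{T_1},\dots,\overline{T_n}$ form a basis of $S$ and for every $i$ there is $j$ with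 $T_i^{(-1)} = T_j$. It is an S-ring (Schur ring) if moreover $T_1 = \{1\}$ (after reordering the $T_i$) and $G = T_1\cup\cdots\cup T_n$. A PS-ring $S$ is central if $S \subseteq Z(FG)$, the center of $FG$, and rational if $\phi(x)=x$ for all $x \in S$ and all $\phi\in\operatorname{Aut}(G)$ (with $\phi$ extended linearly to $FG$). *)

theory Defs
  imports Complex_Main "HOL-Algebra.Coset" "HOL-Algebra.Bij" "HOL-Library.Function_Algebras"
begin

text \<open>Elements of the group algebra \<open>FG\<close> are coefficient functions \<open>'a \<Rightarrow> 'f\<close> that vanish
  outside \<open>carrier G\<close>. Addition is pointwise; since the pointwise \<open>*\<close> on functions is not the
  product of \<open>FG\<close>, the latter gets its own symbol \<open>\<star>\<close>. The group \<open>G\<close> is meant to be finite.\<close>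

definition group_algebra :: "('a, 'b) monoid_scheme \<Rightarrow> ('a \<Rightarrow> 'f::field) set" where
  "group_algebra G = {x. \<forall>g. g \<notin> carrier G \<longrightarrow> x g = 0}"

definition ga_scale :: "'f::field \<Rightarrow> ('a \<Rightarrow> 'f) \<Rightarrow> 'a \<Rightarrow> 'f" (infixr \<open>\<cdot>\<^sub>F\<close> 75) where
  "c \<cdot>\<^sub>F x = (\<lambda>g. c * x g)"

global_interpretation ga: vector_space ga_scale
  by unfold_locales (auto simp: ga_scale_def algebra_simps)

definition ga_mult ::
    "('a, 'b) monoid_scheme \<Rightarrow> ('a \<Rightarrow> 'f::field) \<Rightarrow> ('a \<Rightarrow> 'f) \<Rightarrow> 'a \<Rightarrow> 'f"
    (infixl \<open>\<star>\<index>\<close> 70) where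
  "x \<star>\<^bsub>G\<^esub> y =
    (\<lambda>g. \<Sum>(h, k) \<in> {(h, k) \<in> carrier G \<times> carrier G. h \<otimes>\<^bsub>G\<^esub> k = g}. x h * y k)"

definition ga_center :: "('a, 'b) monoid_scheme \<Rightarrow> ('a \<Rightarrow> 'f::field) set" where
  "ga_center G = {z \<in> group_algebra G. \<forall>x \<in> group_algebra G. z \<star>\<^bsub>G\<^esub> x = x \<star>\<^bsub>G\<^esub> z}"

definition group_elem :: "'a \<Rightarrow> 'a \<Rightarrow> 'f::field" where
  "group_elem g = (\<lambda>h. if h = g then 1 else 0)"

definition set_sum :: "'a set \<Rightarrow> 'a \<Rightarrow> 'f::field" where
  "set_sum C = (\<Sum>g\<in>C. group_elem g)"

definition hadamard :: "('a \<Rightarrow> 'f::field) \<Rightarrow> ('a \<Rightarrow> 'f) \<Rightarrow> 'a \<Rightarrow> 'f" (infixl \<open>\<odot>\<close> 70) where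
  "x \<odot> y = (\<lambda>g. x g * y g)"

text \<open>The linear extension of a map \<open>f\<close> on \<open>G\<close> to \<open>FG\<close>, sending \<open>\<Sum>\<^sub>g a\<^sub>g g\<close> to
  \<open>\<Sum>\<^sub>g a\<^sub>g f(g)\<close>: the coefficients over each fibre of \<open>f\<close> are added up.\<close>

definition lin_ext ::
    "('a, 'b) monoid_scheme \<Rightarrow> ('a \<Rightarrow> 'a) \<Rightarrow> ('a \<Rightarrow> 'f::field) \<Rightarrow> 'a \<Rightarrow> 'f" where
  "lin_ext G f x = (\<lambda>g. \<Sum>h \<in> {h \<in> carrier G. f h = g}. x h)"

definition ga_power :: "('a, 'b) monoid_scheme \<Rightarrow> ('a \<Rightarrow> 'f::field) \<Rightarrow> int \<Rightarrow> 'a \<Rightarrow> 'f" where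
  "ga_power G x m = lin_ext G (\<lambda>g. g [^]\<^bsub>G\<^esub> m) x"

definition set_power :: "('a, 'b) monoid_scheme \<Rightarrow> 'a set \<Rightarrow> int \<Rightarrow> 'a set" where
  "set_power G C m = (\<lambda>g. g [^]\<^bsub>G\<^esub> m) ` C"

text \<open>Subalgebras need not contain the identity of \<open>FG\<close>.\<close>

definition ga_subalgebra :: "('a, 'b) monoid_scheme \<Rightarrow> ('a \<Rightarrow> 'f::field) set \<Rightarrow> bool" where
  "ga_subalgebra G S \<longleftrightarrow>
    S \<subseteq> group_algebra G \<and> ga.subspace S \<and> (\<forall>x\<in>S. \<forall>y\<in>S. x \<star>\<^bsub>G\<^esub> y \<in> S)"

text \<open>Being disjoint and nonempty, the basic sets \<open>T\<^sub>1, \<dots>, T\<^sub>n\<close> are pairwise distinct, so they are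
  given as a set of sets \<open>\<T>\<close>.\<close>

definition basic_sets ::
    "('a, 'b) monoid_scheme \<Rightarrow> ('a \<Rightarrow> 'f::field) set \<Rightarrow> 'a set set \<Rightarrow> bool" where
  "basic_sets G S \<T> \<longleftrightarrow>
    finite \<T> \<and> (\<forall>T\<in>\<T>. T \<noteq> {} \<and> T \<subseteq> carrier G) \<and> pairwise disjnt \<T> \<and>
    ga.independent ((set_sum :: 'a set \<Rightarrow> 'a \<Rightarrow> 'f) ` \<T>) \<and> ga.span (set_sum ` \<T>) = S \<and>
    (\<forall>T\<in>\<T>. \<exists>T'\<in>\<T>. set_power G T (-1) = T')"

definition ps_ring :: "('a, 'b) monoid_scheme \<Rightarrow> ('a \<Rightarrow> 'f::field) set \<Rightarrow> bool" where
  "ps_ring G S \<longleftrightarrow> ga_subalgebra G S \<and> (\<exists>\<T>. basic_sets G S \<T>)"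

definition s_ring :: "('a, 'b) monoid_scheme \<Rightarrow> ('a \<Rightarrow> 'f::field) set \<Rightarrow> bool" where
  "s_ring G S \<longleftrightarrow>
    ga_subalgebra G S \<and> (\<exists>\<T>. basic_sets G S \<T> \<and> {\<one>\<^bsub>G\<^esub>} \<in> \<T> \<and> \<Union>\<T> = carrier G)"

definition central :: "('a, 'b) monoid_scheme \<Rightarrow> ('a \<Rightarrow> 'f::field) set \<Rightarrow> bool" where
  "central G S \<longleftrightarrow> S \<subseteq> ga_center G"

definition rational :: "('a, 'b) monoid_scheme \<Rightarrow> ('a \<Rightarrow> 'f::field) set \<Rightarrow> bool" where
  "rational G S \<longleftrightarrow> (\<forall>\<phi>\<in>auto G. \<forall>x\<in>S. lin_ext G \<phi> x = x)"

definition characteristic :: "'a set \<Rightarrow> ('a, 'b) monoid_scheme \<Rightarrow> bool" where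
  "characteristic H G \<longleftrightarrow> subgroup H G \<and> (\<forall>\<phi>\<in>auto G. \<phi> ` H = H)"

definition normal_sublattice :: "'a set set \<Rightarrow> ('a, 'b) monoid_scheme \<Rightarrow> bool" where
  "normal_sublattice \<L> G \<longleftrightarrow>
    \<L> \<noteq> {} \<and> (\<forall>H\<in>\<L>. H \<lhd> G) \<and> (\<forall>H\<in>\<L>. \<forall>K\<in>\<L>. H \<inter> K \<in> \<L> \<and> H <#>\<^bsub>G\<^esub> K \<in> \<L>)"

definition lattice_span :: "'a set set \<Rightarrow> ('a \<Rightarrow> 'f::field) set" where
  "lattice_span \<L> = ga.span (set_sum ` \<L>)"

end

theory Submission
  imports Defs
begin

text \<open>Call two elements of \<open>G\<close> equivalent when they lie in the same members of \<open>\<L>\<close>. As \<open>\<L>\<close> is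
  closed under intersection, each equivalence class inside \<open>\<Union>\<L>\<close> is some \<open>H \<in> \<L>\<close> with all
  smaller members of \<open>\<L>\<close> removed, and by inclusion-exclusion these classes are the basic sets of
  \<open>F\<L>\<close>. Elements of \<open>F\<L>\<close> are constant on classes and vanish outside \<open>\<Union>\<L>\<close>. Hence if \<open>F\<L>\<close>
  contains the sum over \<open>{1}\<close>, then \<open>\<Inter>\<L> = {1}\<close>, and if it contains the sum over \<open>G\<close>, then
  \<open>\<Union>\<L> = G\<close>; since \<open>\<L>\<close> is a finite lattice, \<open>\<Inter>\<L>\<close> and \<open>\<Union>\<L>\<close> are members of it.\<close>

section \<open>Sums over subsets\<close>

lemma sum_fun_apply: "(\<Sum>a\<in>A. f a) x = (\<Sum>a\<in>A. f a x)"
  by (induction A rule: infinite_finite_induct) auto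

text \<open>Finiteness matters: a sum over an infinite set is 0 by convention.\<close>

lemma set_sum_apply:
  assumes "finite C"
  shows "(set_sum C :: 'a \<Rightarrow> 'f::field) g = (if g \<in> C then 1 else 0)"
  using assms by (simp add: set_sum_def sum_fun_apply group_elem_def)

lemma set_sum_empty [simp]: "set_sum {} = 0"
  by (simp add: set_sum_def)

lemma set_sum_eq_iff:
  assumes "finite C" "finite D"
  shows "(set_sum C :: 'a \<Rightarrow> 'f::field) = set_sum D \<longleftrightarrow> C = D"
proof
  assume eq: "(set_sum C :: 'a \<Rightarrow> 'f) = set_sum D"
  have "g \<in> C \<longleftrightarrow> g \<in> D" for g
    using fun_cong[OF eq, of g] assms by (simp add: set_sum_apply split: if_splits)
  then show "C = D" by blast
qed simp

lemma hadamard_set_sum: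
  assumes "finite C" "finite D"
  shows "(set_sum C :: 'a \<Rightarrow> 'f::field) \<odot> set_sum D = set_sum (C \<inter> D)"
  using assms by (auto simp: hadamard_def set_sum_apply fun_eq_iff)

lemma set_sum_Union_disjoint:
  assumes "finite \<T>" "\<And>T. T \<in> \<T> \<Longrightarrow> finite T" "pairwise disjnt \<T>"
  shows "set_sum (\<Union>\<T>) = (\<Sum>T\<in>\<T>. set_sum T)"
  unfolding set_sum_def using assms
  by (subst sum.Union_disjoint) (auto simp: pairwise_def disjnt_def)

text \<open>By disjointness, evaluating a vanishing combination at a point of \<open>T\<close> kills
  every term but the one for \<open>T\<close>.\<close>

lemma independent_set_sum:
  assumes fin: "finite \<T>" and T: "\<And>T. T \<in> \<T> \<Longrightarrow> finite T \<and> T \<noteq> {}"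
    and disj: "pairwise disjnt \<T>"
  shows "ga.independent ((set_sum :: 'a set \<Rightarrow> 'a \<Rightarrow> 'f::field) ` \<T>)"
proof (rule ga.independent_if_scalars_zero)
  fix u :: "('a \<Rightarrow> 'f) \<Rightarrow> 'f" and x :: "'a \<Rightarrow> 'f"
  assume sum0: "(\<Sum>x\<in>set_sum ` \<T>. u x \<cdot>\<^sub>F x) = 0" and x: "x \<in> set_sum ` \<T>"
  obtain T where TT: "T \<in> \<T>" and x_def: "x = set_sum T" using x by blast
  obtain g where g: "g \<in> T" using T TT by blast
  have inj: "inj_on (set_sum :: 'a set \<Rightarrow> 'a \<Rightarrow> 'f) \<T>"
    using T by (auto simp: inj_on_def set_sum_eq_iff)
  have only: "g \<in> U \<longleftrightarrow> U = T" if "U \<in> \<T>" for U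
    using that TT g disj by (auto simp: pairwise_def disjnt_def)
  have "0 = (\<Sum>U\<in>\<T>. u (set_sum U) \<cdot>\<^sub>F set_sum U) g"
    using sum0 by (simp add: sum.reindex[OF inj])
  also have "\<dots> = (\<Sum>U\<in>\<T>. if U = T then u (set_sum U) else 0)"
    unfolding sum_fun_apply
    by (rule sum.cong) (auto simp: ga_scale_def set_sum_apply T only)
  also have "\<dots> = u x" using fin TT x_def by simp
  finally show "u x = 0" by simp
qed (use fin in simp)

section \<open>Cells of a family of sets closed under intersection\<close>

text \<open>For \<open>\<L>\<close> finite and closed under intersection, these are the points whose
  least containing member is \<open>H\<close>. The cell is empty when \<open>H\<close> is a union of
  smaller members, so \<open>{}\<close> is discarded before cells serve as basic sets.\<close>

definition cell :: "'a set set \<Rightarrow> 'a set \<Rightarrow> 'a set" where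
  "cell \<L> H = H - \<Union>{K \<in> \<L>. K \<subset> H}"

text \<open>No group enters here: passing between members and cells rests on finiteness and
  intersections alone. Joins matter only later, for products and for the top element.\<close>

locale inter_closed =
  fixes \<L> :: "'a set set"
  assumes finite_family: "finite \<L>"
    and finite_member: "H \<in> \<L> \<Longrightarrow> finite H"
    and Int_member: "H \<in> \<L> \<Longrightarrow> K \<in> \<L> \<Longrightarrow> H \<inter> K \<in> \<L>"
begin

lemma finite_cell: "H \<in> \<L> \<Longrightarrow> finite (cell \<L> H)"
  by (simp add: cell_def finite_member)

text \<open>The member \<open>H \<inter> K\<close> contains \<open>g\<close>, so it cannot be
  properly smaller than \<open>H\<close> or \<open>K\<close>; hence it equals both.\<close>

lemma cell_unique:
  assumes "H \<in> \<L>" "K \<in> \<L>" "g \<in> cell \<L> H" "g \<in> cell \<L> K"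
  shows "H = K"
proof -
  have "g \<in> H \<inter> K" "H \<inter> K \<in> \<L>"
    using assms Int_member by (auto simp: cell_def)
  then have "\<not> H \<inter> K \<subset> H" "\<not> H \<inter> K \<subset> K"
    using assms by (auto simp: cell_def)
  then show ?thesis by blast
qed

lemma pairwise_disjnt_cells: "pairwise disjnt (cell \<L> ` \<L>)"
  unfolding pairwise_def disjnt_def using cell_unique by blast

text \<open>A minimal member among those inside \<open>H\<close> that contain \<open>g\<close>
  works: anything smaller still lies inside \<open>H\<close>, so it must miss
  \<open>g\<close>.\<close>

lemma ex_cell:
  assumes "H \<in> \<L>" "g \<in> H"
  obtains K where "K \<in> \<L>" "K \<subseteq> H" "g \<in> cell \<L> K"
proof -
  have "finite {K \<in> \<L>. K \<subseteq> H \<and> g \<in> K}" "{K \<in> \<L>. K \<subseteq> H \<and> g \<in> K} \<noteq> {}"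
    using assms finite_family by auto
  from finite_has_minimal[OF this] obtain K where "K \<in> \<L>" "K \<subseteq> H" "g \<in> K"
    and min: "\<And>J. J \<in> \<L> \<Longrightarrow> J \<subseteq> H \<Longrightarrow> g \<in> J \<Longrightarrow> J \<subseteq> K \<Longrightarrow> K = J"
    by auto
  then have "g \<in> cell \<L> K" unfolding cell_def by blast
  with \<open>K \<in> \<L>\<close> \<open>K \<subseteq> H\<close> show thesis by (rule that)
qed

lemma Union_cells: "\<Union>(cell \<L> ` \<L>) = \<Union>\<L>"
proof
  show "\<Union>(cell \<L> ` \<L>) \<subseteq> \<Union>\<L>" by (auto simp: cell_def)
  show "\<Union>\<L> \<subseteq> \<Union>(cell \<L> ` \<L>)" by (auto elim: ex_cell)
qed

lemma member_eq_Union_cells: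
  assumes "H \<in> \<L>"
  shows "H = \<Union>(cell \<L> ` {K \<in> \<L>. K \<subseteq> H})"
proof
  show "H \<subseteq> \<Union>(cell \<L> ` {K \<in> \<L>. K \<subseteq> H})"
    using assms by (auto elim: ex_cell)
qed (auto simp: cell_def)

text \<open>Inclusion-exclusion, removing one member at a time. \<open>H\<close> is generalized
  because the induction hypothesis is applied to both \<open>H\<close> and
  \<open>H \<inter> K\<close>.\<close>

lemma set_sum_Diff_in_lattice_span:
  assumes "finite \<K>" "\<K> \<subseteq> \<L>" "H \<in> \<L>"
  shows "set_sum (H - \<Union>\<K>) \<in> (lattice_span \<L> :: ('a \<Rightarrow> 'f::field) set)"
  using assms
proof (induction \<K> arbitrary: H rule: finite_induct)
  case empty
  then show ?case by (auto simp: lattice_span_def intro: ga.span_base)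
next
  case (insert K \<K>)
  then have "H \<inter> K \<in> \<L>" by (auto intro: Int_member)
  with insert have "set_sum (H - \<Union>\<K>) - set_sum (H \<inter> K - \<Union>\<K>)
      \<in> (lattice_span \<L> :: ('a \<Rightarrow> 'f) set)"
    unfolding lattice_span_def by (intro ga.span_diff) auto
  moreover have "set_sum (H - \<Union>\<K>) - set_sum (H \<inter> K - \<Union>\<K>)
      = (set_sum (H - \<Union>(insert K \<K>)) :: 'a \<Rightarrow> 'f)"
    using finite_member[OF insert.prems(2)] by (auto simp: fun_eq_iff set_sum_apply)
  ultimately show ?case by simp
qed

text \<open>Cells are in the span by inclusion-exclusion; conversely each member is the disjoint
  union of the cells of the members below it.\<close>

lemma span_set_sum_cells:
  "ga.span (set_sum ` (cell \<L> ` \<L> - {{}})) = (lattice_span \<L> :: ('a \<Rightarrow> 'f::field) set)"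
proof (rule ga.span_unique)
  show "set_sum ` (cell \<L> ` \<L> - {{}}) \<subseteq> (lattice_span \<L> :: ('a \<Rightarrow> 'f) set)"
    using finite_family by (auto simp: cell_def intro!: set_sum_Diff_in_lattice_span)
  show "ga.subspace (lattice_span \<L> :: ('a \<Rightarrow> 'f) set)"
    by (simp add: lattice_span_def)
  fix S :: "('a \<Rightarrow> 'f) set"
  assume S: "set_sum ` (cell \<L> ` \<L> - {{}}) \<subseteq> S" "ga.subspace S"
  have "set_sum H \<in> S" if H: "H \<in> \<L>" for H
  proof -
    let ?C = "cell \<L> ` {K \<in> \<L>. K \<subseteq> H}"
    have "(set_sum H :: 'a \<Rightarrow> 'f) = set_sum (\<Union>?C)"
      using member_eq_Union_cells[OF H] by simp
    also have "\<dots> = (\<Sum>T\<in>?C. set_sum T)"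
      by (rule set_sum_Union_disjoint)
        (use finite_family finite_cell in \<open>auto intro!: pairwise_subset[OF pairwise_disjnt_cells]\<close>)
    also have "\<dots> \<in> S"
    proof (rule ga.subspace_sum[OF S(2)])
      fix T assume "T \<in> ?C"
      \<comment> \<open>An empty cell is not among the generators, but its sum is 0 and so lies in
        every subspace.\<close>
      then show "set_sum T \<in> S"
        using S ga.subspace_0 by (cases "T = {}") auto
    qed
    finally show ?thesis .
  qed
  then show "lattice_span \<L> \<subseteq> S"
    unfolding lattice_span_def using S(2) by (intro ga.span_minimal) auto
qed

text \<open>The condition is linear in \<open>x\<close>, and on the sum over a member it is just
  \<open>gh\<close>.\<close>

lemma lattice_span_eq_on_classes:
  assumes x: "x \<in> (lattice_span \<L> :: ('a \<Rightarrow> 'f::field) set)"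
    and gh: "\<And>H. H \<in> \<L> \<Longrightarrow> g \<in> H \<longleftrightarrow> h \<in> H"
  shows "x g = x h"
  using x unfolding lattice_span_def
proof (induction rule: ga.span_induct_alt)
  case (step c x y)
  then show ?case using gh finite_member by (auto simp: ga_scale_def set_sum_apply)
qed simp

lemma lattice_span_eq_0:
  assumes x: "x \<in> (lattice_span \<L> :: ('a \<Rightarrow> 'f::field) set)" and g: "g \<notin> \<Union>\<L>"
  shows "x g = 0"
  using x unfolding lattice_span_def
proof (induction rule: ga.span_induct_alt)
  case (step c x y)
  then show ?case using g finite_member by (auto simp: ga_scale_def set_sum_apply)
qed simp

end

section \<open>The group algebra\<close>

lemma ga_mult_add_left: "(x + y) \<star>\<^bsub>G\<^esub> z = x \<star>\<^bsub>G\<^esub> z + y \<star>\<^bsub>G\<^esub> z"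
  by (simp add: ga_mult_def fun_eq_iff case_prod_unfold distrib_right sum.distrib)

lemma ga_mult_add_right: "z \<star>\<^bsub>G\<^esub> (x + y) = z \<star>\<^bsub>G\<^esub> x + z \<star>\<^bsub>G\<^esub> y"
  by (simp add: ga_mult_def fun_eq_iff case_prod_unfold distrib_left sum.distrib)

lemma ga_mult_scale_left: "(c \<cdot>\<^sub>F x) \<star>\<^bsub>G\<^esub> z = c \<cdot>\<^sub>F (x \<star>\<^bsub>G\<^esub> z)"
  by (simp add: ga_mult_def ga_scale_def fun_eq_iff case_prod_unfold sum_distrib_left mult.assoc)

lemma ga_mult_scale_right: "z \<star>\<^bsub>G\<^esub> (c \<cdot>\<^sub>F x) = c \<cdot>\<^sub>F (z \<star>\<^bsub>G\<^esub> x)"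
  by (simp add: ga_mult_def ga_scale_def fun_eq_iff case_prod_unfold sum_distrib_left
      mult.left_commute)

lemma ga_mult_zero_left [simp]: "0 \<star>\<^bsub>G\<^esub> z = 0"
  by (simp add: ga_mult_def fun_eq_iff)

lemma ga_mult_zero_right [simp]: "z \<star>\<^bsub>G\<^esub> 0 = 0"
  by (simp add: ga_mult_def fun_eq_iff)

lemma subspace_group_algebra: "ga.subspace (group_algebra G)"
  by (auto simp: ga.subspace_def group_algebra_def ga_scale_def)

lemma subspace_ga_center: "ga.subspace (ga_center G)"
  using subspace_group_algebra[of G]
  by (auto simp: ga.subspace_def ga_center_def ga_mult_add_left ga_mult_add_right
      ga_mult_scale_left ga_mult_scale_right)

lemma set_sum_in_group_algebra:
  "finite C \<Longrightarrow> C \<subseteq> carrier G \<Longrightarrow> set_sum C \<in> group_algebra G"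
  by (auto simp: group_algebra_def set_sum_apply)

section \<open>Linear extensions and properties inherited by spans\<close>

lemma lin_ext_zero [simp]: "lin_ext G f 0 = 0"
  by (simp add: lin_ext_def fun_eq_iff)

lemma lin_ext_add: "lin_ext G f (x + y) = lin_ext G f x + lin_ext G f y"
  by (simp add: lin_ext_def fun_eq_iff sum.distrib)

lemma lin_ext_scale: "lin_ext G f (c \<cdot>\<^sub>F x) = c \<cdot>\<^sub>F lin_ext G f x"
  by (simp add: lin_ext_def ga_scale_def fun_eq_iff sum_distrib_left)

lemma lin_ext_set_sum:
  assumes "finite (carrier G)" "inj_on f (carrier G)" "C \<subseteq> carrier G"
  shows "lin_ext G f (set_sum C :: 'a \<Rightarrow> 'f::field) = set_sum (f ` C)"
proof
  fix g
  have C: "finite C" using assms finite_subset by blast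
  show "lin_ext G f (set_sum C :: 'a \<Rightarrow> 'f) g = set_sum (f ` C) g"
  proof (cases "g \<in> f ` C")
    case True
    then obtain c where c: "c \<in> C" "g = f c" by blast
    then have "{h \<in> carrier G. f h = g} = {c}"
      using assms by (auto simp: inj_on_def)
    then show ?thesis using C c by (simp add: lin_ext_def set_sum_apply)
  next
    case False
    then have "lin_ext G f (set_sum C :: 'a \<Rightarrow> 'f) g = 0"
      unfolding lin_ext_def using C by (intro sum.neutral) (auto simp: set_sum_apply)
    then show ?thesis using C False by (simp add: set_sum_apply)
  qed
qed

text \<open>The fixed points of a linear map form a subspace, so fixing the generators
  suffices.\<close>

lemma rational_span_iff:
  "rational G (ga.span B) \<longleftrightarrow> (\<forall>\<phi>\<in>auto G. \<forall>x\<in>B. lin_ext G \<phi> x = x)"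
proof
  assume "rational G (ga.span B)"
  then show "\<forall>\<phi>\<in>auto G. \<forall>x\<in>B. lin_ext G \<phi> x = x"
    by (auto simp: rational_def ga.span_base)
next
  assume B: "\<forall>\<phi>\<in>auto G. \<forall>x\<in>B. lin_ext G \<phi> x = x"
  have "ga.span B \<subseteq> {x. lin_ext G \<phi> x = x}" if "\<phi> \<in> auto G" for \<phi>
    by (rule ga.span_minimal)
      (use B that in \<open>auto simp: ga.subspace_def lin_ext_add lin_ext_scale\<close>)
  then show "rational G (ga.span B)" by (auto simp: rational_def)
qed

lemma ga_subalgebra_span:
  assumes "B \<subseteq> group_algebra G"
    and mult: "\<And>x y. x \<in> B \<Longrightarrow> y \<in> B \<Longrightarrow> x \<star>\<^bsub>G\<^esub> y \<in> ga.span B"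
  shows "ga_subalgebra G (ga.span B)"
proof -
  have "ga.span B \<subseteq> {y. x \<star>\<^bsub>G\<^esub> y \<in> ga.span B}" if "x \<in> B" for x
    by (rule ga.span_minimal)
      (use that mult in \<open>auto simp: ga.subspace_def ga_mult_add_right ga_mult_scale_right
        ga.span_zero ga.span_add ga.span_scale\<close>)
  \<comment> \<open>Bilinearity is used one factor at a time: the right factor already ranges over
    the span, and now the left one is extended.\<close>
  then have "ga.span B \<subseteq> {x. x \<star>\<^bsub>G\<^esub> y \<in> ga.span B}" if "y \<in> ga.span B" for y
    by (intro ga.span_minimal)
      (use that in \<open>auto simp: ga.subspace_def ga_mult_add_left ga_mult_scale_left
        ga.span_zero ga.span_add ga.span_scale\<close>)
  then show ?thesis
    using ga.span_minimal[OF assms(1) subspace_group_algebra]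
    by (auto simp: ga_subalgebra_def)
qed

section \<open>Coefficients of products, centrality and counting factorizations\<close>

context group
begin

text \<open>A factorization of \<open>g\<close> is determined by its left factor, which turns the
  sum over pairs into a single sum; the next lemma uses the right factor instead.\<close>

lemma ga_mult_apply_left:
  assumes "g \<in> carrier G"
  shows "(x \<star> y) g = (\<Sum>h\<in>carrier G. x h * y (inv h \<otimes> g))"
  unfolding ga_mult_def
  by (rule sum.reindex_bij_witness[of _ "\<lambda>h. (h, inv h \<otimes> g)" fst])
    (use assms in \<open>auto simp: m_assoc[symmetric]\<close>)

lemma ga_mult_apply_right:
  assumes "g \<in> carrier G"
  shows "(x \<star> y) g = (\<Sum>k\<in>carrier G. x (g \<otimes> inv k) * y k)"
  unfolding ga_mult_def
  by (rule sum.reindex_bij_witness[of _ "\<lambda>k. (g \<otimes> inv k, k)" snd])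
    (use assms in \<open>auto simp: m_assoc\<close>)

lemma ga_mult_apply_outside:
  assumes "g \<notin> carrier G"
  shows "(x \<star> y) g = 0"
  unfolding ga_mult_def using assms by (intro sum.neutral) auto

text \<open>Expanding one product by its right factor and the other by its left factor gives sums
  over the same index with the same coefficients of \<open>x\<close>; only the two membership tests
  for \<open>H\<close> have to be matched.\<close>

lemma normal_set_sum_in_ga_center:
  assumes fin: "finite (carrier G)" and H: "H \<lhd> G"
  shows "(set_sum H :: 'a \<Rightarrow> 'f::field) \<in> ga_center G"
proof -
  interpret H: normal H G by fact
  have finH: "finite H" using fin H.subset finite_subset by blast
  \<comment> \<open>The two elements are conjugate under \<open>k\<close>, so normality identifies
    the conditions.\<close>
  have mem: "g \<otimes> inv k \<in> H \<longleftrightarrow> inv k \<otimes> g \<in> H"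
    if "g \<in> carrier G" "k \<in> carrier G" for g k
  proof
    assume "g \<otimes> inv k \<in> H"
    from H.inv_op_closed1[OF that(2) this] show "inv k \<otimes> g \<in> H"
      using that by (simp add: m_assoc)
  next
    assume "inv k \<otimes> g \<in> H"
    from H.inv_op_closed2[OF that(2) this] show "g \<otimes> inv k \<in> H"
      using that by (simp add: m_assoc[symmetric])
  qed
  have "set_sum H \<star> x = x \<star> set_sum H" for x :: "'a \<Rightarrow> 'f"
  proof
    fix g
    show "(set_sum H \<star> x) g = (x \<star> set_sum H) g"
    proof (cases "g \<in> carrier G")
      case True
      show ?thesis
        unfolding ga_mult_apply_right[OF True, of "set_sum H"] ga_mult_apply_left[OF True, of x]
        by (rule sum.cong) (use True mem finH in \<open>auto simp: set_sum_apply\<close>)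
    qed (simp add: ga_mult_apply_outside)
  qed
  then show ?thesis
    using set_sum_in_group_algebra[OF finH H.subset] by (simp add: ga_center_def)
qed

text \<open>From one factorization \<open>g = a \<otimes> b\<close> all others arise as
  \<open>(a \<otimes> d) \<otimes> (inv d \<otimes> b)\<close> with
  \<open>d \<in> H \<inter> K\<close>.\<close>

lemma card_factorizations:
  assumes H: "subgroup H G" and K: "subgroup K G" and g: "g \<in> H <#> K"
  shows "card {h \<in> H. inv h \<otimes> g \<in> K} = card (H \<inter> K)"
proof -
  interpret H: subgroup H G by fact
  interpret K: subgroup K G by fact
  obtain a b where ab: "a \<in> H" "b \<in> K" "g = a \<otimes> b"
    using g by (auto simp: set_mult_def)
  have "bij_betw (\<lambda>d. a \<otimes> d) (H \<inter> K) {h \<in> H. inv h \<otimes> g \<in> K}"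
  proof (rule bij_betw_byWitness[where f' = "\<lambda>h. inv a \<otimes> h"])
    show "(\<lambda>h. inv a \<otimes> h) ` {h \<in> H. inv h \<otimes> g \<in> K} \<subseteq> H \<inter> K"
    proof clarify
      fix h assume h: "h \<in> H" "inv h \<otimes> g \<in> K"
      have carr: "a \<in> carrier G" "b \<in> carrier G" "h \<in> carrier G"
        using ab h by auto
      \<comment> \<open>This element of \<open>K\<close> is \<open>inv a \<otimes> h\<close> in
        disguise, since \<open>inv g = inv b \<otimes> inv a\<close>.\<close>
      have "b \<otimes> inv (inv h \<otimes> g) \<in> K" using h ab by blast
      also have "b \<otimes> inv (inv h \<otimes> g) = inv a \<otimes> h"
        using carr ab(3) by (simp add: inv_mult_group m_assoc[symmetric])
      finally show "inv a \<otimes> h \<in> H \<inter> K" using ab h by blast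
    qed
    show "(\<otimes>) a ` (H \<inter> K) \<subseteq> {h \<in> H. inv h \<otimes> g \<in> K}"
    proof clarify
      fix d assume d: "d \<in> H" "d \<in> K"
      have carr: "a \<in> carrier G" "b \<in> carrier G" "d \<in> carrier G"
        using ab d by auto
      have "inv (a \<otimes> d) \<otimes> g = inv d \<otimes> b"
        using carr ab(3) by (simp add: inv_mult_group m_assoc inv_solve_left')
      then show "a \<otimes> d \<in> H \<and> inv (a \<otimes> d) \<otimes> g \<in> K" using ab d by auto
    qed
  qed (use ab in \<open>auto simp: m_assoc[symmetric]\<close>)
  then show ?thesis by (simp add: bij_betw_same_card)
qed

text \<open>The coefficient at \<open>g\<close> counts factorizations of \<open>g\<close> with
  factors in \<open>H\<close> and \<open>K\<close>. The count is read in the field, so it may vanish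
  there in positive characteristic.\<close>

lemma set_sum_mult_subgroups:
  assumes fin: "finite (carrier G)" and H: "subgroup H G" and K: "subgroup K G"
  shows "(set_sum H :: 'a \<Rightarrow> 'f::field) \<star> set_sum K
    = of_nat (card (H \<inter> K)) \<cdot>\<^sub>F set_sum (H <#> K)"
proof
  fix g
  interpret H: subgroup H G by fact
  interpret K: subgroup K G by fact
  have finite: "finite H" "finite K" "finite (H <#> K)"
    using fin H.subset K.subset set_mult_closed[OF H.subset K.subset]
    by (auto intro: finite_subset)
  show "((set_sum H :: 'a \<Rightarrow> 'f) \<star> set_sum K) g
      = (of_nat (card (H \<inter> K)) \<cdot>\<^sub>F set_sum (H <#> K)) g"
  proof (cases "g \<in> carrier G")
    case True
    have "((set_sum H :: 'a \<Rightarrow> 'f) \<star> set_sum K) g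
        = (\<Sum>h\<in>carrier G. if h \<in> {h \<in> H. inv h \<otimes> g \<in> K} then 1 else 0)"
      unfolding ga_mult_apply_left[OF True]
      by (rule sum.cong) (use finite in \<open>auto simp: set_sum_apply\<close>)
    also have "\<dots> = of_nat (card (carrier G \<inter> {h \<in> H. inv h \<otimes> g \<in> K}))"
      by (subst sum.inter_restrict[OF fin, symmetric]) simp
    also have "carrier G \<inter> {h \<in> H. inv h \<otimes> g \<in> K} = {h \<in> H. inv h \<otimes> g \<in> K}"
      by auto
    finally have eq: "((set_sum H :: 'a \<Rightarrow> 'f) \<star> set_sum K) g
        = of_nat (card {h \<in> H. inv h \<otimes> g \<in> K})" .
    show ?thesis
    proof (cases "g \<in> H <#> K")
      case True
      then show ?thesis
        using eq finite card_factorizations[OF H K True] by (simp add: ga_scale_def set_sum_apply)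
    next
      case False
      \<comment> \<open>Any \<open>h\<close> counted here would exhibit \<open>g\<close> as an
        element of \<open>H <#> K\<close>.\<close>
      have "h \<otimes> (inv h \<otimes> g) = g" if "h \<in> H" for h
        using that \<open>g \<in> carrier G\<close> by (simp add: m_assoc[symmetric])
      with False have "{h \<in> H. inv h \<otimes> g \<in> K} = {}"
        unfolding set_mult_def by force
      then have "((set_sum H :: 'a \<Rightarrow> 'f) \<star> set_sum K) g = 0"
        unfolding eq by (simp only: card.empty of_nat_0)
      then show ?thesis using finite False by (simp add: ga_scale_def set_sum_apply)
    qed
  next
    case False
    then have "g \<notin> H <#> K"
      using set_mult_closed[OF H.subset K.subset] by blast
    with False finite show ?thesis
      by (simp add: ga_mult_apply_outside ga_scale_def set_sum_apply)
  qed
qed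

section \<open>Inversion and automorphisms acting on subgroup sums\<close>

lemma int_pow_minus_one: "x \<in> carrier G \<Longrightarrow> x [^] (-1 :: int) = inv x"
  by (simp add: int_pow_neg)

lemma set_power_minus_one: "C \<subseteq> carrier G \<Longrightarrow> set_power G C (-1) = m_inv G ` C"
  unfolding set_power_def by (rule image_cong) (auto simp: int_pow_minus_one)

lemma subgroup_inv_image:
  assumes "subgroup H G"
  shows "m_inv G ` H = H"
proof -
  interpret subgroup H G by fact
  have "h \<in> m_inv G ` H" if "h \<in> H" for h
    using that by (intro image_eqI[of _ _ "inv h"]) auto
  then show ?thesis by auto
qed

lemma ga_power_minus_one_subgroup:
  assumes "finite (carrier G)" "subgroup H G"
  shows "ga_power G (set_sum H :: 'a \<Rightarrow> 'f::field) (-1) = set_sum H"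
proof -
  interpret subgroup H G by fact
  have "inj_on (\<lambda>g. g [^] (-1 :: int)) (carrier G)"
    using inv_inj by (simp add: inj_on_def int_pow_minus_one)
  then have "ga_power G (set_sum H :: 'a \<Rightarrow> 'f) (-1) = set_sum (set_power G H (-1))"
    using assms(1) subset by (simp add: ga_power_def lin_ext_set_sum set_power_def)
  then show ?thesis
    using assms(2) by (simp add: set_power_minus_one subgroup_inv_image subset)
qed

text \<open>An automorphism sends the sum over \<open>H\<close> to the sum over its image, and a
  finite set is determined by its sum because 0 and 1 differ in a field.\<close>

lemma rational_lattice_span_iff:
  assumes fin: "finite (carrier G)" and sub: "\<And>H. H \<in> \<L> \<Longrightarrow> subgroup H G"
  shows "rational G (lattice_span \<L> :: ('a \<Rightarrow> 'f::field) set)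
    \<longleftrightarrow> (\<forall>H\<in>\<L>. characteristic H G)"
proof -
  have "lin_ext G \<phi> (set_sum H :: 'a \<Rightarrow> 'f) = set_sum H \<longleftrightarrow> \<phi> ` H = H"
    if "\<phi> \<in> auto G" "H \<in> \<L>" for \<phi> H
  proof -
    have "inj_on \<phi> (carrier G)"
      using that(1) by (simp add: auto_def Bij_def bij_betw_def)
    moreover have "H \<subseteq> carrier G" using sub that(2) subgroup.subset by blast
    moreover from this have "finite H" using fin finite_subset by blast
    ultimately show ?thesis using fin by (simp add: lin_ext_set_sum set_sum_eq_iff)
  qed
  then show ?thesis
    using sub by (simp add: lattice_span_def rational_span_iff characteristic_def) blast
qed

end

section \<open>Sublattices of normal subgroups\<close>

locale normal_lattice = group G for G :: "('a, 'b) monoid_scheme" (structure) +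
  fixes \<L> :: "'a set set"
  assumes finite_carrier: "finite (carrier G)"
    and normal_sublattice: "normal_sublattice \<L> G"
begin

lemma nonempty: "\<L> \<noteq> {}"
  using normal_sublattice by (simp add: normal_sublattice_def)

lemma normal_member: "H \<in> \<L> \<Longrightarrow> H \<lhd> G"
  using normal_sublattice by (simp add: normal_sublattice_def)

lemma subgroup_member: "H \<in> \<L> \<Longrightarrow> subgroup H G"
  using normal_member normal_imp_subgroup by blast

lemma member_subset: "H \<in> \<L> \<Longrightarrow> H \<subseteq> carrier G"
  using subgroup_member subgroup.subset by blast

lemma join_member: "H \<in> \<L> \<Longrightarrow> K \<in> \<L> \<Longrightarrow> H <#> K \<in> \<L>"
  using normal_sublattice by (simp add: normal_sublattice_def)

sublocale inter_closed \<L>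
proof
  have "\<L> \<subseteq> Pow (carrier G)" using member_subset by blast
  then show "finite \<L>" using finite_carrier by (simp add: finite_subset)
  show "finite H" if "H \<in> \<L>" for H
    using member_subset[OF that] finite_carrier by (rule finite_subset)
  show "H \<inter> K \<in> \<L>" if "H \<in> \<L>" "K \<in> \<L>" for H K
    using that normal_sublattice by (simp add: normal_sublattice_def)
qed

section \<open>Top and bottom of the lattice\<close>

lemma subset_join:
  assumes "H \<in> \<L>" "K \<in> \<L>"
  shows "H \<subseteq> H <#> K" "K \<subseteq> H <#> K"
proof -
  interpret H: subgroup H G using assms(1) by (rule subgroup_member)
  interpret K: subgroup K G using assms(2) by (rule subgroup_member)
  show "H \<subseteq> H <#> K"
  proof
    fix h assume "h \<in> H"
    then have "h = h \<otimes> \<one>" by simp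
    with \<open>h \<in> H\<close> show "h \<in> H <#> K" unfolding set_mult_def using K.one_closed by blast
  qed
  show "K \<subseteq> H <#> K"
  proof
    fix k assume "k \<in> K"
    then have "k = \<one> \<otimes> k" by simp
    with \<open>k \<in> K\<close> show "k \<in> H <#> K" unfolding set_mult_def using H.one_closed by blast
  qed
qed

text \<open>A maximal member \<open>M\<close> equals its join with any \<open>H\<close>, hence
  contains \<open>H\<close>. The next proof is dual, with a minimal member and
  intersections.\<close>

lemma Union_member: "\<Union>\<L> \<in> \<L>"
proof -
  obtain M where M: "M \<in> \<L>" "\<And>H. H \<in> \<L> \<Longrightarrow> M \<subseteq> H \<Longrightarrow> M = H"
    using finite_has_maximal[OF finite_family nonempty] by blast
  have "H \<subseteq> M" if "H \<in> \<L>" for H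
    using M(2)[OF join_member[OF M(1) that]] subset_join[OF M(1) that] by blast
  then have "\<Union>\<L> = M" using M(1) by blast
  with M(1) show ?thesis by simp
qed

lemma Inter_member: "\<Inter>\<L> \<in> \<L>"
proof -
  obtain M where M: "M \<in> \<L>" "\<And>H. H \<in> \<L> \<Longrightarrow> H \<subseteq> M \<Longrightarrow> M = H"
    using finite_has_minimal[OF finite_family nonempty] by blast
  have "M \<subseteq> H" if "H \<in> \<L>" for H
    using M(2)[OF Int_member[OF M(1) that]] by blast
  then have "\<Inter>\<L> = M" using M(1) by blast
  with M(1) show ?thesis by simp
qed

lemma one_in_member: "H \<in> \<L> \<Longrightarrow> \<one> \<in> H"
  using subgroup_member subgroup.one_closed by blast

text \<open>An element and its inverse lie in the same subgroups, so inversion maps each cell onto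
  itself; every basic set is thus its own partner.\<close>

lemma set_power_cell:
  assumes "H \<in> \<L>"
  shows "set_power G (cell \<L> H) (-1) = cell \<L> H"
proof -
  have sub: "cell \<L> H \<subseteq> carrier G"
    using member_subset[OF assms] by (auto simp: cell_def)
  have inv_cell: "inv g \<in> cell \<L> H" if "g \<in> cell \<L> H" for g
  proof -
    have "inv g \<in> K \<longleftrightarrow> g \<in> K" if "K \<in> \<L>" for K
      using subgroup_member[OF that] \<open>g \<in> cell \<L> H\<close> sub
      by (metis inv_inv subgroup.m_inv_closed subsetD)
    with that assms show ?thesis by (auto simp: cell_def)
  qed
  have "g \<in> m_inv G ` cell \<L> H" if "g \<in> cell \<L> H" for g
    using inv_cell[OF that] that sub by (intro image_eqI[of _ _ "inv g"]) auto
  with inv_cell show ?thesis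
    unfolding set_power_minus_one[OF sub] by blast
qed

section \<open>Ring properties of the span\<close>

lemma basic_sets_cells:
  "basic_sets G (lattice_span \<L> :: ('a \<Rightarrow> 'f::field) set) (cell \<L> ` \<L> - {{}})"
  unfolding basic_sets_def
proof (intro conjI)
  let ?\<T> = "cell \<L> ` \<L> - {{}}"
  show "finite ?\<T>" using finite_family by simp
  show "\<forall>T\<in>?\<T>. T \<noteq> {} \<and> T \<subseteq> carrier G"
    using member_subset unfolding cell_def by blast
  show disj: "pairwise disjnt ?\<T>"
    using pairwise_disjnt_cells by (rule pairwise_subset) blast
  show "ga.independent ((set_sum :: 'a set \<Rightarrow> 'a \<Rightarrow> 'f) ` ?\<T>)"
    using disj finite_family finite_cell by (intro independent_set_sum) auto
  show "ga.span (set_sum ` ?\<T>) = (lattice_span \<L> :: ('a \<Rightarrow> 'f) set)"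
    by (rule span_set_sum_cells)
  show "\<forall>T\<in>?\<T>. \<exists>T'\<in>?\<T>. set_power G T (-1) = T'"
    using set_power_cell by auto
qed

lemma ga_subalgebra_lattice_span:
  "ga_subalgebra G (lattice_span \<L> :: ('a \<Rightarrow> 'f::field) set)"
  unfolding lattice_span_def
proof (rule ga_subalgebra_span)
  show "set_sum ` \<L> \<subseteq> (group_algebra G :: ('a \<Rightarrow> 'f) set)"
    using finite_member member_subset by (auto intro!: set_sum_in_group_algebra)
  show "x \<star> y \<in> ga.span (set_sum ` \<L>)" if "x \<in> set_sum ` \<L>" "y \<in> set_sum ` \<L>"
    for x y :: "'a \<Rightarrow> 'f"
  proof -
    from that obtain H K where "H \<in> \<L>" "x = set_sum H" "K \<in> \<L>" "y = set_sum K"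
      by blast
    moreover from this have "set_sum (H <#> K) \<in> ga.span (set_sum ` \<L> :: ('a \<Rightarrow> 'f) set)"
      using join_member by (blast intro: ga.span_base)
    ultimately show ?thesis
      by (simp add: set_sum_mult_subgroups finite_carrier subgroup_member ga.span_scale)
  qed
qed

lemma central_lattice_span: "central G (lattice_span \<L> :: ('a \<Rightarrow> 'f::field) set)"
  unfolding central_def lattice_span_def
  by (rule ga.span_minimal)
    (auto simp: subspace_ga_center normal_set_sum_in_ga_center finite_carrier normal_member)

lemma s_ring_lattice_span_iff:
  "s_ring G (lattice_span \<L> :: ('a \<Rightarrow> 'f::field) set) \<longleftrightarrow> {\<one>} \<in> \<L> \<and> carrier G \<in> \<L>"
proof
  assume "s_ring G (lattice_span \<L> :: ('a \<Rightarrow> 'f) set)"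
  \<comment> \<open>These basic sets need not be compared with the cells: it is enough that the sums
    over \<open>{\<one>}\<close> and over sets covering \<open>G\<close> lie in the span.\<close>
  then obtain \<T> where basic: "basic_sets G (lattice_span \<L> :: ('a \<Rightarrow> 'f) set) \<T>"
    and one: "{\<one>} \<in> \<T>" and un: "\<Union>\<T> = carrier G"
    by (auto simp: s_ring_def)
  have base: "set_sum T \<in> (lattice_span \<L> :: ('a \<Rightarrow> 'f) set)" if "T \<in> \<T>" for T
    using basic that ga.span_base[of "set_sum T :: 'a \<Rightarrow> 'f" "set_sum ` \<T>"] by (simp add: basic_sets_def)
  have "g = \<one>" if "g \<in> \<Inter>\<L>" for g
  proof -
    \<comment> \<open>Both \<open>g\<close> and \<open>\<one>\<close> lie in every member, so an
      element of the span cannot tell them apart.\<close>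
    have "(set_sum {\<one>} :: 'a \<Rightarrow> 'f) g = set_sum {\<one>} \<one>"
      using that one_in_member by (intro lattice_span_eq_on_classes[OF base[OF one]]) auto
    then show ?thesis by (simp add: set_sum_apply split: if_splits)
  qed
  then have "\<Inter>\<L> = {\<one>}" using one_in_member by auto
  then have "{\<one>} \<in> \<L>" using Inter_member by simp
  moreover have "g \<in> \<Union>\<L>" if "g \<in> carrier G" for g
  proof (rule ccontr)
    assume g: "g \<notin> \<Union>\<L>"
    have "g \<in> \<Union>\<T>" using that un by simp
    then obtain T where T: "T \<in> \<T>" "g \<in> T" by (rule UnionE)
    have "T \<subseteq> carrier G" using Union_upper[OF T(1)] un by simp
    \<comment> \<open>Finiteness ensures that the coefficient of \<open>g\<close> in the sum over
      \<open>T\<close> is 1, against the value 0 forced outside \<open>\<Union>\<L>\<close>.\<close>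
    then have "finite T" using finite_carrier by (rule finite_subset)
    then show False
      using lattice_span_eq_0[OF base[OF T(1)] g] T(2) by (simp add: set_sum_apply)
  qed
  then have "\<Union>\<L> = carrier G"
    by (intro subset_antisym subsetI Union_least member_subset)
  then have "carrier G \<in> \<L>" using Union_member by simp
  ultimately show "{\<one>} \<in> \<L> \<and> carrier G \<in> \<L>" ..
next
  assume L: "{\<one>} \<in> \<L> \<and> carrier G \<in> \<L>"
  \<comment> \<open>Every member contains \<open>\<one>\<close>, so none is properly inside
    \<open>{\<one>}\<close> and nothing is removed.\<close>
  have "cell \<L> {\<one>} = {\<one>}" using one_in_member by (auto simp: cell_def)
  then have "{\<one>} \<in> cell \<L> ` \<L> - {{}}" 
    using L by (auto intro: image_eqI[of _ _ "{\<one>}"])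
  moreover have "\<Union>(cell \<L> ` \<L> - {{}}) = carrier G"
  proof -
    have "\<Union>(cell \<L> ` \<L> - {{}}) = \<Union>\<L>"
      unfolding Union_cells[symmetric] by blast
    also have "\<dots> = carrier G"
      using L by (intro subset_antisym Union_least member_subset) auto
    finally show ?thesis .
  qed
  ultimately show "s_ring G (lattice_span \<L> :: ('a \<Rightarrow> 'f) set)"
    unfolding s_ring_def using ga_subalgebra_lattice_span basic_sets_cells by blast
qed

end

theorem theorem2p3:
  fixes G :: "('a, 'b) monoid_scheme" and \<L> :: "'a set set"
    and FL :: "('a \<Rightarrow> 'f::field) set"
  assumes "group G" and "finite (carrier G)"
    and "normal_sublattice \<L> G"
    and "FL = lattice_span \<L>"
  shows "central G FL \<and> ps_ring G FL \<and>
    (\<forall>H\<in>\<L>. \<forall>K\<in>\<L>.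
      ga_power G (set_sum H :: 'a \<Rightarrow> 'f) (-1) = set_sum H \<and>
      (set_sum H :: 'a \<Rightarrow> 'f) \<odot> set_sum K = set_sum (H \<inter> K) \<and>
      (set_sum H :: 'a \<Rightarrow> 'f) \<star>\<^bsub>G\<^esub> set_sum K
        = of_nat (card (H \<inter> K)) \<cdot>\<^sub>F set_sum (H <#>\<^bsub>G\<^esub> K)) \<and>
    (s_ring G FL \<longleftrightarrow> {\<one>\<^bsub>G\<^esub>} \<in> \<L> \<and> carrier G \<in> \<L>) \<and>
    (rational G FL \<longleftrightarrow> (\<forall>H\<in>\<L>. characteristic H G))"
proof -
  interpret normal_lattice G \<L>
    using assms(1-3) by (simp add: normal_lattice_def normal_lattice_axioms_def)
  have "ps_ring G FL"
    unfolding ps_ring_def assms(4) using ga_subalgebra_lattice_span basic_sets_cells by blast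
  then show ?thesis
    using assms(4) finite_carrier subgroup_member
    by (simp add: central_lattice_span s_ring_lattice_span_iff rational_lattice_span_iff
        ga_power_minus_one_subgroup hadamard_set_sum finite_member set_sum_mult_subgroups)
qed

end
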